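(* If $n=p_1^{\alpha_1}p_2^{\alpha_2}\cdots p_r^{\alpha_r}$, where $r \geq 2$, $p_1 < p_2 < \cdots < p_r$ are primes and $\alpha_j \in \mathbb{N}$ for $1 \leq j \leq r$, then $$\kappa(\mathcal{G}(\mathbb{Z}_n)) \leq \phi(n)+\frac{n}{p_r} - p_r^{\alpha_r-1} \phi\left(\frac{n}{p_r^{\alpha_r}}\right).$$
   Context: $\mathbb{N}$ denotes the positive integers and $\phi$ is Euler's phi function. $\mathbb{Z}_n$ is the additive group of integers modulo $n$. The power graph $\mathcal{G}(\mathbb{Z}_n)$ is the simple undirected graph with vertex set $\mathbb{Z}_n$ in which two distinct vertices are adjacent if one is a positive integer multiple of the other. The vertex connectivity $\kappa(\Gamma)$ of a graph $\Gamma$ is the minimum number of vertices whose removal results in a disconnected graph or a trivial graph (one vertex, no edges). *)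

theory Defs
  imports
    "HOL-Algebra.Elementary_Groups"
    "HOL-Number_Theory.Totient"
    "Graph_Theory.Graph_Theory"
begin

text \<open>
  Simple undirected graphs are represented, as in Graph_Theory, by symmetric loop-free digraphs
  without parallel arcs: an edge between x and y is the pair of arcs (x, y) and (y, x).
\<close>

definition power_graph :: "('a, 'b) monoid_scheme \<Rightarrow> 'a pair_pre_digraph" where
  "power_graph G =
     \<lparr> pverts = carrier G,
       parcs = {(x, y). x \<in> carrier G \<and> y \<in> carrier G \<and> x \<noteq> y \<and>
                  (\<exists>m::nat. 0 < m \<and> (y = x [^]\<^bsub>G\<^esub> m \<or> x = y [^]\<^bsub>G\<^esub> m))} \<rparr>"

lemma pair_graph_power_graph:
  assumes "finite (carrier G)"
  shows "pair_graph (power_graph G)"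
proof
  show "finite (parcs (power_graph G))"
    by (rule finite_subset[of _ "carrier G \<times> carrier G"])
       (use assms in \<open>auto simp: power_graph_def\<close>)
  show "symmetric (with_proj (power_graph G))"
    by (auto simp: symmetric_def sym_def power_graph_def)
qed (use assms in \<open>auto simp: power_graph_def\<close>)

text \<open>
  The nonemptiness condition is needed because the library's notion of connectedness is false
  for the graph without vertices, which is not to be counted as disconnected.
\<close>

definition disconnected_graph :: "('a, 'b) pre_digraph \<Rightarrow> bool" where
  "disconnected_graph G \<longleftrightarrow> verts G \<noteq> {} \<and> \<not> Digraph_Component.connected G"

definition trivial_graph :: "('a, 'b) pre_digraph \<Rightarrow> bool" where
  "trivial_graph G \<longleftrightarrow> card (verts G) = 1 \<and> arcs G = {}"

definition separating_set :: "('a, 'b) pre_digraph \<Rightarrow> 'a set \<Rightarrow> bool" where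
  "separating_set G S \<longleftrightarrow> finite S \<and> S \<subseteq> verts G \<and>
     (disconnected_graph (G \<restriction> (verts G - S)) \<or> trivial_graph (G \<restriction> (verts G - S)))"

definition vertex_connectivity :: "('a, 'b) pre_digraph \<Rightarrow> nat" where
  "vertex_connectivity G = (LEAST k. \<exists>S. separating_set G S \<and> card S = k)"

text \<open>The minimum is over a nonempty set whenever the graph is simple, finite and nonempty.\<close>

lemma (in graph) vertex_connectivity_attained:
  assumes "verts G \<noteq> {}"
  shows "\<exists>S. separating_set G S \<and> card S = vertex_connectivity G"
proof -
  obtain v where v: "v \<in> verts G"
    using assms by blast
  then have "verts G - (verts G - {v}) = {v}"
    by blast
  then have "separating_set G (verts G - {v})"
    by (auto simp: separating_set_def trivial_graph_def) (metis no_loops)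
  then show ?thesis
    unfolding vertex_connectivity_def
    by (intro LeastI_ex[of "\<lambda>k. \<exists>S. separating_set G S \<and> card S = k"]) blast
qed

end

theory Submission
  imports Defs
begin

text \<open>
  Write \<open>n = q ^ a * m\<close> with \<open>q = p r\<close> and \<open>m\<close> prime to \<open>q\<close>; as \<open>r \<ge> 2\<close>, \<open>m > 1\<close>.
  In the power graph of the integers modulo \<open>n\<close> the neighbours of \<open>x\<close> are multiples of \<open>x\<close> or have
  \<open>x\<close> as a multiple, and passing to a multiple modulo \<open>n\<close> keeps every divisor of \<open>x\<close> that also
  divides \<open>n\<close>. Delete all generators, and all multiples of \<open>q\<close> that share a factor with \<open>m\<close>.
  Each surviving vertex is of one of two kinds: the multiples of \<open>q\<close> survive only if they are
  prime to \<open>m\<close>, and the others, not being generators, share a prime factor with \<open>m\<close>. An edge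
  between the two kinds would make \<open>q\<close> divide a vertex of the second kind, or would carry a prime
  factor of \<open>m\<close> over to a vertex of the first kind, so there is none. Both kinds occur, as witnessed
  by \<open>q\<close> and by \<open>m\<close> itself, so the remaining graph is disconnected.

  The deleted set consists of \<open>totient n\<close> generators and of those among the \<open>n div q\<close> multiples of
  \<open>q\<close> that are not prime to \<open>m\<close>. Writing such a multiple as \<open>q * y\<close> with \<open>y < q ^ (a - 1) * m\<close>, the
  excluded \<open>y\<close> are the ones prime to \<open>m\<close>; they fill \<open>totient m\<close> residue classes in each of
  \<open>q ^ (a - 1)\<close> periods. This is the claimed bound.
\<close>

section \<open>Vertex connectivity and separations\<close>

text \<open>Walks, even in the symmetric closure, cannot leave a side that no arc leaves or enters.\<close>

lemma disconnected_graphI: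
  assumes verts: "verts G = A \<union> B" and disj: "A \<inter> B = {}" and ne: "A \<noteq> {}" "B \<noteq> {}"
    and no_arc: "\<And>e. e \<in> arcs G \<Longrightarrow> tail G e \<in> A \<longleftrightarrow> head G e \<in> A"
  shows "disconnected_graph G"
proof -
  obtain u v where uv: "u \<in> A" "v \<in> B"
    using ne by blast
  have "y \<in> A" if "(u, y) \<in> rtrancl_on (verts G) (parcs (mk_symmetric G))" for y
    using that
  proof (induction rule: rtrancl_on_induct)
    case base
    show ?case by (fact uv)
  next
    case (step y z)
    then show ?case
      using no_arc by (auto simp: parcs_mk_symmetric)
  qed
  then have "\<not> u \<rightarrow>\<^sup>*\<^bsub>mk_symmetric G\<^esub> v"
    using uv disj by (auto simp: reachable_def)
  then show ?thesis
    using uv verts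
    by (auto simp: disconnected_graph_def Digraph_Component.connected_def strongly_connected_def)
qed

lemma vertex_connectivity_le:
  assumes "separating_set G S"
  shows "vertex_connectivity G \<le> card S"
  unfolding vertex_connectivity_def by (rule Least_le) (use assms in blast)

section \<open>Counting residues prime to a modulus\<close>

lemma card_coprime_less:
  assumes "m > 0"
  shows "card {y. y < m \<and> coprime y m} = totient m"
proof (cases "m = 1")
  case True
  then have "{y. y < m \<and> coprime y m} = {0}"
    by auto
  then show ?thesis using True by simp
next
  case False
  with assms have "m > 1" by simp
  then have "{y. y < m \<and> coprime y m} = totatives m"
    by (auto simp: in_totatives_iff totatives_less intro!: Nat.gr0I)
  then show ?thesis by (simp add: totient_def)
qed

text \<open>Being prime to \<open>m\<close> depends only on the residue modulo \<open>m\<close>, so every period counts the same.\<close>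

lemma card_coprime_less_mult:
  assumes "m > 0"
  shows "card {y. y < c * m \<and> coprime y m} = c * totient m"
proof (induction c)
  case 0
  show ?case by simp
next
  case (Suc c)
  have shift: "coprime (c * m + y) m \<longleftrightarrow> coprime y m" for y
    by (metis add.commute coprime_iff_gcd_eq_1 gcd.commute gcd_add_mult)
  have "{y. y < Suc c * m \<and> coprime y m}
      = {y. y < c * m \<and> coprime y m} \<union> (\<lambda>y. c * m + y) ` {y. y < m \<and> coprime y m}"
    (is "_ = ?L \<union> ?R")
  proof (intro equalityI subsetI)
    fix y assume y: "y \<in> {y. y < Suc c * m \<and> coprime y m}"
    show "y \<in> ?L \<union> ?R"
    proof (cases "y < c * m")
      case True
      with y show ?thesis by simp
    next
      case False
      then have "y = c * m + (y - c * m)" by simp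
      moreover from this have "coprime (y - c * m) m"
        using y shift by (metis mem_Collect_eq)
      ultimately show ?thesis
        using y False by (auto intro!: image_eqI[of _ _ "y - c * m"])
    qed
  qed (auto simp: shift)
  moreover have "?L \<inter> ?R = {}" by auto
  moreover have "card ?R = totient m"
    using assms by (subst card_image) (auto simp: card_coprime_less)
  ultimately show ?case
    using Suc.IH by (simp add: card_Un_disjoint)
qed

section \<open>A separating set of the power graph\<close>

text \<open>
  Passing from \<open>x\<close> to a multiple of it, even after reduction modulo \<open>n\<close>, can only enlarge the set
  of common divisors with \<open>n\<close>.
\<close>

lemma dvd_mod_mult:
  fixes d k x n :: nat
  assumes "d dvd x" "d dvd n"
  shows "d dvd (k * x) mod n"
  using assms by (simp add: dvd_mod)

lemma parcs_power_graph_integer_mod_groupE: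
  assumes "(u, v) \<in> parcs (power_graph (integer_mod_group n))" and "n > 0"
  obtains x y k where "u = int x" "v = int y" "x < n" "y < n"
    "y = (k * x) mod n \<or> x = (k * y) mod n"
proof -
  have uv: "u = int (nat u)" "v = int (nat v)" "nat u < n" "nat v < n"
    and ex: "\<exists>k. v = (int k * u) mod int n \<or> u = (int k * v) mod int n"
    using assms by (auto simp: power_graph_def carrier_integer_mod_group nat_less_iff)
  from ex obtain k where "v = (int k * u) mod int n \<or> u = (int k * v) mod int n" ..
  then have "nat v = (k * nat u) mod n \<or> nat u = (k * nat v) mod n"
    using uv(1,2) by (metis nat_int of_nat_mod of_nat_mult)
  with uv show thesis by (rule that)
qed

text \<open>
  Among the non-generators, deleting the multiples of \<open>q\<close> that are not prime to \<open>m\<close> removes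
  exactly the vertices through which \<open>q\<close> could be linked to a divisor of \<open>m\<close>. The vertices are
  given as natural numbers, where the totient function counts.
\<close>

definition power_graph_cut :: "nat \<Rightarrow> nat \<Rightarrow> nat \<Rightarrow> nat set" where
  "power_graph_cut q m n = {x. x < n \<and> (coprime x n \<or> q dvd x \<and> \<not> coprime x m)}"

text \<open>
  With \<open>c = n div q\<close>, division by \<open>q\<close> turns the deleted multiples of \<open>q\<close> into the \<open>y < c\<close> that are
  not prime to \<open>m\<close>; since \<open>c\<close> is a multiple of \<open>m\<close>, the complementary \<open>y\<close> fill whole periods.
\<close>

lemma card_power_graph_cut_le:
  assumes "prime q" "a \<ge> 1" "coprime q m" "m > 0" and n: "n = q ^ a * m"
  shows "card (power_graph_cut q m n) + q ^ (a - 1) * totient m \<le> totient n + n div q"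
proof -
  define c where "c = q ^ (a - 1) * m"
  have q0: "q > 0" using assms(1) by (simp add: prime_gt_0_nat)
  have nc: "n = q * c"
    using assms(2) by (cases a) (auto simp: n c_def)
  have n0: "n > 0" using q0 assms(4) by (simp add: n)
  have "{x. x < n \<and> q dvd x \<and> \<not> coprime x m} = (*) q ` {y. y < c \<and> \<not> coprime y m}"
    using assms(3) q0 by (auto simp: nc elim!: dvdE)
  moreover have "inj_on ((*) q) {y. y < c \<and> \<not> coprime y m}"
    using q0 by (auto simp: inj_on_def)
  ultimately have multiples: "card {x. x < n \<and> q dvd x \<and> \<not> coprime x m}
      = card {y. y < c \<and> \<not> coprime y m}"
    by (simp add: card_image)
  have "{..<c} = {y. y < c \<and> \<not> coprime y m} \<union> {y. y < c \<and> coprime y m}"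
    by auto
  then have "card {..<c} = card ({y. y < c \<and> \<not> coprime y m} \<union> {y. y < c \<and> coprime y m})"
    by (rule arg_cong)
  also have "\<dots> = card {y. y < c \<and> \<not> coprime y m} + card {y. y < c \<and> coprime y m}"
    by (rule card_Un_disjoint) auto
  also have "card {y. y < c \<and> coprime y m} = q ^ (a - 1) * totient m"
    unfolding c_def by (rule card_coprime_less_mult) fact
  finally have c: "c = card {y. y < c \<and> \<not> coprime y m} + q ^ (a - 1) * totient m"
    by simp
  have "power_graph_cut q m n
      = {x. x < n \<and> coprime x n} \<union> {x. x < n \<and> q dvd x \<and> \<not> coprime x m}"
    by (auto simp: power_graph_cut_def)
  then have "card (power_graph_cut q m n)
      \<le> totient n + card {x. x < n \<and> q dvd x \<and> \<not> coprime x m}"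
    using card_Un_le[of "{x. x < n \<and> coprime x n}"] card_coprime_less[OF n0] by simp
  moreover have "n div q = c" using q0 by (simp add: nc)
  ultimately show ?thesis using c multiples by linarith
qed

text \<open>
  The survivors divisible by \<open>q\<close> (\<open>A\<close>) are prime to \<open>m\<close>, and the others (\<open>B\<close>) are not, for
  otherwise they would be generators. An edge would pass a divisor of \<open>n\<close> from one of its ends to
  the other, and neither \<open>q\<close> nor a factor of \<open>m\<close> can cross.
\<close>

lemma separating_set_power_graph_cut:
  assumes "prime q" "a \<ge> 1" "coprime q m" "m > 1" and n: "n = q ^ a * m"
  shows "separating_set (with_proj (power_graph (integer_mod_group n)))
    (int ` power_graph_cut q m n)"
proof -
  define G where "G = with_proj (power_graph (integer_mod_group n))"
  define A where "A = {x. x < n \<and> q dvd x \<and> coprime x m}"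
  define B where "B = {x. x < n \<and> \<not> q dvd x \<and> \<not> coprime x m}"
  have q1: "q > 1" using assms(1) by (rule prime_gt_1_nat)
  have n0: "n > 0" using q1 assms(4) by (simp add: n)
  have qn: "q dvd n" using assms(2) by (auto simp: n)
  have mn: "m dvd n" by (simp add: n)
  have "verts G = {0..<int n}"
    using n0 by (simp add: G_def power_graph_def carrier_integer_mod_group)
  then have verts: "verts G = int ` {..<n}"
    by (simp add: image_int_atLeastLessThan lessThan_atLeast0)
  have coprime_n: "coprime x n \<longleftrightarrow> \<not> q dvd x \<and> coprime x m" for x
    using assms(1,2) by (auto simp: n coprime_commute[of x] prime_imp_coprime_nat
        dest: coprime_common_divisor[of q x q] not_prime_unit)
  have "{..<n} - power_graph_cut q m n = A \<union> B"
    by (auto simp: power_graph_cut_def A_def B_def coprime_n)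
  then have rest: "verts G - int ` power_graph_cut q m n = int ` A \<union> int ` B"
    unfolding verts by (simp add: image_set_diff[symmetric] image_Un[symmetric])
  have "q ^ 1 \<le> q ^ a"
    using q1 assms(2) by (intro power_increasing) auto
  then have qa: "q \<le> q ^ a" by simp
  have "q < q * m" "m < q * m" using q1 assms(4) by auto
  then have "q < n" "m < n"
    using mult_le_mono1[OF qa, of m] unfolding n by linarith+
  then have "q \<in> A" "m \<in> B"
    using assms(1,3,4) q1 by (auto simp: A_def B_def dest: coprime_common_divisor)
  have no_arc: "u \<in> int ` A \<longleftrightarrow> v \<in> int ` A"
    if arc: "(u, v) \<in> arcs G" and "u \<in> int ` A \<union> int ` B" "v \<in> int ` A \<union> int ` B" for u v
  proof -
    \<comment> \<open>If \<open>y\<close> is the multiple, it inherits the divisor \<open>q\<close>; if \<open>x\<close> is, it inherits \<open>gcd y m\<close>.\<close>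
    have no_step: False
      if "x \<in> A" "y \<in> B" and k: "y = (k * x) mod n \<or> x = (k * y) mod n" for x y k
      using k
    proof
      assume "y = (k * x) mod n"
      then have "q dvd y" using \<open>x \<in> A\<close> qn by (simp add: A_def dvd_mod_mult)
      then show False using \<open>y \<in> B\<close> by (simp add: B_def)
    next
      assume x: "x = (k * y) mod n"
      have "gcd y m dvd x"
        unfolding x using mn by (intro dvd_mod_mult) (auto intro: dvd_trans)
      then have "gcd y m = 1"
        using \<open>x \<in> A\<close> by (auto simp: A_def dest: coprime_common_divisor)
      then show False using \<open>y \<in> B\<close> by (simp add: B_def coprime_iff_gcd_eq_1)
    qed
    have "(u, v) \<in> parcs (power_graph (integer_mod_group n))"
      using arc by (simp add: G_def)
    then obtain x y k where "u = int x" "v = int y"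
      "y = (k * x) mod n \<or> x = (k * y) mod n"
      using n0 by (rule parcs_power_graph_integer_mod_groupE)
    with that no_step[of x y k] no_step[of y x k] show ?thesis
      by auto
  qed
  have "disconnected_graph (G \<restriction> (verts G - int ` power_graph_cut q m n))"
    unfolding rest
  proof (rule disconnected_graphI)
    show "int ` A \<inter> int ` B = {}" by (auto simp: A_def B_def)
    show "int ` A \<noteq> {}" "int ` B \<noteq> {}" using \<open>q \<in> A\<close> \<open>m \<in> B\<close> by auto
    fix e assume "e \<in> arcs (G \<restriction> (int ` A \<union> int ` B))"
    then show "tail (G \<restriction> (int ` A \<union> int ` B)) e \<in> int ` A
        \<longleftrightarrow> head (G \<restriction> (int ` A \<union> int ` B)) e \<in> int ` A"
      using no_arc[of "fst e" "snd e"] by (simp add: G_def)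
  qed simp
  moreover have "finite (power_graph_cut q m n)" "power_graph_cut q m n \<subseteq> {..<n}"
    by (auto simp: power_graph_cut_def)
  ultimately show ?thesis
    unfolding separating_set_def G_def[symmetric] verts by auto
qed

section \<open>The upper bound\<close>

lemma vertex_connectivity_power_graph_le:
  assumes "prime q" "a \<ge> 1" "coprime q m" "m > 1" "n = q ^ a * m"
  shows "vertex_connectivity (with_proj (power_graph (integer_mod_group n)))
    + q ^ (a - 1) * totient m \<le> totient n + n div q"
proof -
  have "vertex_connectivity (with_proj (power_graph (integer_mod_group n)))
      \<le> card (int ` power_graph_cut q m n)"
    using assms by (intro vertex_connectivity_le separating_set_power_graph_cut)
  also have "\<dots> = card (power_graph_cut q m n)"
    by (rule card_image) simp
  finally show ?thesis
    using card_power_graph_cut_le[of q a m n] assms by simp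
qed

theorem theorem2p13:
  fixes n r :: nat and p \<alpha> :: "nat \<Rightarrow> nat"
  assumes "r \<ge> 2"
    and "\<And>j. j \<in> {1..r} \<Longrightarrow> prime (p j)"
    and "strict_mono_on {1..r} p"
    and "\<And>j. j \<in> {1..r} \<Longrightarrow> \<alpha> j \<ge> 1"
    and "n = (\<Prod>j=1..r. p j ^ \<alpha> j)"
  shows "int (vertex_connectivity (with_proj (power_graph (integer_mod_group n))))
      \<le> int (totient n) + int (n div p r)
        - int (p r ^ (\<alpha> r - 1) * totient (n div p r ^ \<alpha> r))"
proof -
  define m where "m = (\<Prod>j\<in>{1..<r}. p j ^ \<alpha> j)"
  have r: "r \<in> {1..r}" using assms(1) by simp
  have prime_r: "prime (p r)" and \<alpha>_r: "\<alpha> r \<ge> 1"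
    using assms(2,4) r by auto
  have "{1..r} = insert r {1..<r}" using assms(1) by auto
  then have n: "n = p r ^ \<alpha> r * m"
    by (simp add: assms(5) m_def)
  have "coprime (p r) (p j ^ \<alpha> j)" if "j \<in> {1..<r}" for j
  proof -
    have "p j < p r"
      using that r by (intro strict_mono_onD[OF assms(3)]) auto
    then have "coprime (p r) (p j)"
      using prime_r assms(2)[of j] that by (intro primes_coprime) auto
    then show ?thesis by simp
  qed
  then have coprime: "coprime (p r) m"
    unfolding m_def by (rule prod_coprime_right)
  have "p 1 ^ \<alpha> 1 dvd m"
    unfolding m_def using assms(1) by (intro dvd_prodI) auto
  moreover have "p 1 dvd p 1 ^ \<alpha> 1"
    using assms(1,4) by (intro dvd_power) (auto simp: Suc_le_eq)
  moreover have "\<not> p 1 dvd 1"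
    using assms(1) assms(2)[of 1] by auto
  ultimately have "m \<noteq> 1" by (metis dvd_trans)
  moreover have "m \<noteq> 0"
    using assms(2) by (auto simp: m_def intro!: prime_gt_0_nat)
  ultimately have "m > 1" by simp
  from vertex_connectivity_power_graph_le[OF prime_r \<alpha>_r coprime this n]
  have "int (vertex_connectivity (with_proj (power_graph (integer_mod_group n)))
      + p r ^ (\<alpha> r - 1) * totient m) \<le> int (totient n + n div p r)"
    by (simp only: of_nat_le_iff)
  moreover have "n div p r ^ \<alpha> r = m"
    using prime_r by (simp add: n prime_gt_0_nat)
  ultimately show ?thesis by simp
qed

end
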